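(* Suppose that the distribution $\mu$ of the single-site variables $v(x)$ in the Anderson model $H_A$ (so that $k=1$ and $A_\omega(x)=v(x)$) is compactly supported on the interval $I=[-b,b]$ for some $b>0$ and is $\beta$-regular, i.e. for any Lebesgue-measurable $S\subset I$ we have $$\mu(S)\le C|S|^{\beta},$$ where $|S|$ is the Lebesgue measure of $S$ and $C$ is a constant. Then Assumption (A) (stated in the context) holds with $\alpha=\beta$.
   Context: The Anderson model $H_A$ is the random operator $(H_A\psi)(x)=(\Delta\psi)(x)+g\,v(x)\psi(x)$ on $\ell^2(\mathbb Z^d)$ (or its restriction to a finite box), where $\Delta$ is the discrete Laplacian, $g$ is a coupling constant, and the $v(x)$ are independent, identically distributed real random variables on a probability space $(\Omega,\mathbb P)$. Assumption (A), for i.i.d. random Hermitian $k\times k$ matrices $A_\omega(x)$, $\omega\in\Omega$: For an integer $n$, let $\mathcal S$ be a given set of $2nk$ distinct integers. Then the matrix $A_\omega(x)-a$ is invertible for all $a\in\mathcal S$ and all $\omega\in\Omega$. Moreover, there exists an $\alpha>0$ such that, for any integer $a\in\mathcal S$, any $\epsilon\in[0,1]$ and arbitrary Hermitian $k\times k$ matrix $J$ (with $J+a$ invertible), the bound $$\mathbb P\left(\left|\det\left((A_\omega(x)-a)^{-1}+(J+a)^{-1}\right)\right|\le\epsilon\right)\le K\epsilon^{\alpha}$$ holds, where $K$ is a constant. Here a scalar $a$ stands for $a$ times the identity matrix; for $k=1$ the matrices are real numbers and the determinant is the number itself.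
   Formalization: Invertibility of v(x)-a for all ω can fail on a null set if S meets I; so for arbitrary S it is claimed only on an event of probability one, and for all ω when every v(x) takes values in I and S is disjoint from I. β>0 is made explicit. *)

theory Defs
  imports "HOL-Probability.Probability"
begin

definition hermitian :: "complex ^ 'k ^ 'k \<Rightarrow> bool" where
  "hermitian J \<longleftrightarrow> (\<chi> i j. cnj (J $ j $ i)) = J"

definition iid_hermitian_field ::
    "'w measure \<Rightarrow> 'x set \<Rightarrow> ('x \<Rightarrow> 'w \<Rightarrow> complex ^ 'k ^ 'k) \<Rightarrow> bool" where
  "iid_hermitian_field M \<Lambda> A \<longleftrightarrow>
     prob_space M \<and>
     prob_space.indep_vars M (\<lambda>_. borel) A \<Lambda> \<and>
     (\<forall>x\<in>\<Lambda>. \<forall>y\<in>\<Lambda>. distr M borel (A x) = distr M borel (A y)) \<and>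
     (\<forall>x\<in>\<Lambda>. \<forall>\<omega>\<in>space M. hermitian (A x \<omega>))"

text \<open>
  Assumption (A) with exponent \<open>\<alpha>\<close>.  The argument \<open>\<Omega>\<^sub>0\<close> is the set of realizations
  \<open>\<omega>\<close> for which \<open>A x \<omega> - a\<close> has to be invertible; the assumption proper is
  \<open>\<Omega>\<^sub>0 = space M\<close>, and a set of probability one gives its almost sure version.
  The constant \<open>K\<close> depends neither on the site \<open>x\<close>, nor on \<open>a\<close>, \<open>\<epsilon>\<close> or \<open>J\<close>.
  Where \<open>A x \<omega> - a\<close> is singular, \<open>matrix_inv\<close> is an unspecified matrix; this can
  only happen outside \<open>\<Omega>\<^sub>0\<close>.
\<close>

definition assumption_A_on ::
    "'w measure \<Rightarrow> 'w set \<Rightarrow> 'x set \<Rightarrow> ('x \<Rightarrow> 'w \<Rightarrow> complex ^ 'k ^ 'k) \<Rightarrow>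
     nat \<Rightarrow> int set \<Rightarrow> real \<Rightarrow> bool" where
  "assumption_A_on M \<Omega>\<^sub>0 \<Lambda> A n S \<alpha> \<longleftrightarrow>
     iid_hermitian_field M \<Lambda> A \<and>
     finite S \<and> card S = 2 * n * CARD('k) \<and>
     (\<forall>x\<in>\<Lambda>. \<forall>a\<in>S. \<forall>\<omega>\<in>\<Omega>\<^sub>0. invertible (A x \<omega> - mat (of_int a))) \<and>
     \<alpha> > 0 \<and>
     (\<exists>K::real. \<forall>x\<in>\<Lambda>. \<forall>a\<in>S. \<forall>\<epsilon>\<in>{0..1::real}. \<forall>J.
        hermitian J \<and> invertible (J + mat (of_int a)) \<longrightarrow>
        measure M {\<omega>\<in>space M.
            cmod (det (matrix_inv (A x \<omega> - mat (of_int a))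
                       + matrix_inv (J + mat (of_int a)))) \<le> \<epsilon>}
          \<le> K * \<epsilon> powr \<alpha>)"

definition assumption_A ::
    "'w measure \<Rightarrow> 'x set \<Rightarrow> ('x \<Rightarrow> 'w \<Rightarrow> complex ^ 'k ^ 'k) \<Rightarrow>
     nat \<Rightarrow> int set \<Rightarrow> real \<Rightarrow> bool" where
  "assumption_A M \<Lambda> A n S \<alpha> \<longleftrightarrow> assumption_A_on M (space M) \<Lambda> A n S \<alpha>"

text \<open>
  The law \<open>\<mu>\<close> is a Borel measure; its completion gives a meaning to \<open>\<mu>(S)\<close> for
  sets \<open>S\<close> that are Lebesgue but not Borel measurable.
\<close>

definition beta_regular :: "real set \<Rightarrow> real \<Rightarrow> real \<Rightarrow> real measure \<Rightarrow> bool" where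
  "beta_regular I C \<beta> \<mu> \<longleftrightarrow>
     (\<forall>S\<in>sets lebesgue. S \<subseteq> I \<longrightarrow>
        measure (completion \<mu>) S \<le> C * measure lebesgue S powr \<beta>)"

end

theory Submission
  imports Defs
begin

text \<open>
  For \<open>k = 1\<close> put \<open>t = v(x) - a\<close> and \<open>s = J + a\<close>.  Since \<open>\<bar>t\<bar> \<le> R = b + \<bar>a\<bar>\<close>, the number \<open>1/t\<close> is
  at least \<open>1/R\<close> in modulus, so for \<open>\<epsilon> R \<le> 1/2\<close> the bound \<open>\<bar>1/t + 1/s\<bar> \<le> \<epsilon>\<close> forces \<open>\<bar>s\<bar> \<le> 2 R\<close>
  and then \<open>\<bar>v(x) + J\<bar> = \<bar>t\<bar> \<bar>s\<bar> \<bar>1/t + 1/s\<bar> \<le> 2 R\<^sup>2 \<epsilon>\<close>, uniformly in \<open>J\<close>.  Regularity of \<open>\<mu>\<close>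
  bounds the probability of this interval; for \<open>\<epsilon> R > 1/2\<close> the trivial bound \<open>1 \<le> (2 R \<epsilon>)\<^sup>\<beta>\<close>
  suffices.
\<close>

section \<open>One-by-one matrices and sums of inverses\<close>

lemma invertible_1x1_iff:
  fixes A :: "'a::field ^ 1 ^ 1"
  shows "invertible A \<longleftrightarrow> A $ 1 $ 1 \<noteq> 0"
  by (simp add: invertible_det_nz det_1)

lemma matrix_inv_1x1:
  fixes A :: "'a::field ^ 1 ^ 1"
  assumes "A $ 1 $ 1 \<noteq> 0"
  shows "matrix_inv A $ 1 $ 1 = 1 / A $ 1 $ 1"
proof -
  have "A ** matrix_inv A = mat 1"
    using assms invertible_1x1_iff[of A]
    unfolding matrix_inv_def invertible_def by (metis (mono_tags, lifting) someI_ex)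
  then have "(A ** matrix_inv A) $ 1 $ 1 = 1"
    by (simp add: mat_def)
  then have "A $ 1 $ 1 * matrix_inv A $ 1 $ 1 = 1"
    by (simp add: matrix_matrix_mult_def)
  then show ?thesis
    using assms by (simp add: field_simps)
qed

lemma norm_add_le_of_norm_inverse_add_le:
  fixes t s :: "'a::real_normed_field"
  assumes "t \<noteq> 0" "s \<noteq> 0" "norm t \<le> R" "\<epsilon> * R \<le> 1 / 2" "norm (1 / t + 1 / s) \<le> \<epsilon>"
  shows "norm (t + s) \<le> 2 * R\<^sup>2 * \<epsilon>"
proof -
  have R: "R > 0"
    using assms(1,3) by (meson less_le_trans zero_less_norm_iff)
  have \<epsilon>: "\<epsilon> \<ge> 0"
    using assms(5) norm_ge_zero order_trans by blast
  have "1 / R \<le> norm (1 / t)"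
    using assms(1,3) R by (simp add: norm_divide frac_le)
  also have "\<dots> \<le> norm (1 / t + 1 / s) + norm (1 / s)"
    by (metis add_diff_cancel_right' norm_triangle_ineq4)
  also have "\<dots> \<le> \<epsilon> + 1 / norm s"
    using assms(5) by (simp add: norm_divide)
  \<comment> \<open>Smallness of \<epsilon> absorbs half of the lower bound \<open>1 / R\<close>,
    and the other half is left for \<open>1 / norm s\<close>.\<close>
  also have "\<epsilon> \<le> 1 / (2 * R)"
    using assms(4) R by (simp add: field_simps)
  finally have "1 / (2 * R) \<le> 1 / norm s"
    using R by (simp add: field_simps)
  then have s: "norm s \<le> 2 * R"
    using R assms(2) by (simp add: field_simps)
  have "t + s = (t * s) * (1 / t + 1 / s)"
    using assms(1,2) by (simp add: field_simps)
  then have "norm (t + s) = (norm t * norm s) * norm (1 / t + 1 / s)"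
    by (metis norm_mult)
  also have "\<dots> \<le> (R * (2 * R)) * \<epsilon>"
    using assms(3,5) s R by (intro mult_mono) auto
  finally show ?thesis
    by (simp add: power2_eq_square)
qed

section \<open>The random field of scalar matrices\<close>

lemma borel_measurable_mat [measurable]:
  "(\<lambda>r. mat (complex_of_real r) :: complex ^ 'k ^ 'k) \<in> borel_measurable borel"
proof (intro borel_measurable_continuous_onI)
  have "continuous_on UNIV (\<lambda>r. if i = j then complex_of_real r else 0)" for i j :: 'k
    by (cases "i = j") (auto intro: continuous_intros)
  then show "continuous_on UNIV (\<lambda>r. mat (complex_of_real r) :: complex ^ 'k ^ 'k)"
    unfolding mat_def by (intro continuous_on_vec_lambda)
qed

lemma hermitian_mat_of_real: "hermitian (mat (complex_of_real r))"
  by (simp add: hermitian_def mat_def vec_eq_iff)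

lemma iid_hermitian_field_mat:
  assumes "prob_space M"
    and "prob_space.indep_vars M (\<lambda>_. borel) v \<Lambda>"
    and "\<And>x. x \<in> \<Lambda> \<Longrightarrow> distr M borel (v x) = \<mu>"
  shows "iid_hermitian_field M \<Lambda> (\<lambda>x \<omega>. mat (complex_of_real (v x \<omega>)) :: complex ^ 'k ^ 'k)"
proof -
  interpret prob_space M by fact
  let ?f = "\<lambda>r. mat (complex_of_real r) :: complex ^ 'k ^ 'k"
  \<comment> \<open>The right-hand side does not mention \<open>x\<close>, which makes the matrices
    identically distributed.\<close>
  have "distr M borel (\<lambda>\<omega>. ?f (v x \<omega>)) = distr \<mu> borel ?f" if "x \<in> \<Lambda>" for x
  proof -
    have "v x \<in> borel_measurable M"
      using assms(2) that by (simp add: indep_vars_def)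
    then have "distr (distr M borel (v x)) borel ?f = distr M borel (?f \<circ> v x)"
      by (intro distr_distr) auto
    then show ?thesis
      using assms(3) that by (simp add: comp_def)
  qed
  moreover have "indep_vars (\<lambda>_. borel) (\<lambda>x \<omega>. ?f (v x \<omega>)) \<Lambda>"
    using assms(2) by (rule indep_vars_compose2) auto
  ultimately show ?thesis
    unfolding iid_hermitian_field_def
    using prob_space_axioms by (simp add: hermitian_mat_of_real)
qed

section \<open>Consequences of regularity for the single-site law\<close>

text \<open>Completion leaves the measure of an already measurable set unchanged, so both
  completions in \<open>beta_regular\<close> drop out on Borel sets.\<close>

lemma beta_regular_measure_le:
  assumes "beta_regular I C \<beta> \<mu>" "sets \<mu> = sets borel" "A \<in> sets borel" "A \<subseteq> I"
  shows "measure \<mu> A \<le> C * measure lborel A powr \<beta>"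
proof -
  have "A \<in> sets lborel"
    using assms(3) by simp
  then have "A \<in> sets lebesgue" "measure lebesgue A = measure lborel A"
    by (rule sets_completionI_sets, rule measure_completion)
  moreover have "measure (completion \<mu>) A = measure \<mu> A"
    using assms(2,3) by (intro measure_completion) simp
  ultimately show ?thesis
    using assms(1,4) unfolding beta_regular_def by metis
qed

text \<open>Regularity speaks only of subsets of \<open>I\<close>, hence the intersection. Its
  length is at most \<open>2 * r\<close>, and the signs of \<open>C\<close> and \<beta> make the
  regularity bound monotone in the length.\<close>

lemma beta_regular_interval_le:
  assumes "beta_regular I C \<beta> \<mu>" "sets \<mu> = sets borel" "I \<in> sets borel"
    and "C \<ge> 0" "\<beta> > 0" "r \<ge> 0"
  shows "measure \<mu> ({c - r..c + r} \<inter> I) \<le> C * (2 * r) powr \<beta>"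
proof -
  have "measure \<mu> ({c - r..c + r} \<inter> I) \<le> C * measure lborel ({c - r..c + r} \<inter> I) powr \<beta>"
    using assms(1-3) by (intro beta_regular_measure_le) auto
  also have "measure lborel ({c - r..c + r} \<inter> I) \<le> measure lborel {c - r..c + r}"
    using assms(3) by (intro measure_mono_fmeasurable) (auto intro: fmeasurable_compact)
  then have "C * measure lborel ({c - r..c + r} \<inter> I) powr \<beta> \<le> C * (2 * r) powr \<beta>"
    using assms(4-6) by (intro mult_left_mono powr_mono2) auto
  finally show ?thesis .
qed

context
  fixes \<mu> :: "real measure" and b C \<beta> :: real
  assumes prob_\<mu>: "prob_space \<mu>" and sets_\<mu>: "sets \<mu> = sets borel"
    and supp_\<mu>: "measure \<mu> {-b..b} = 1"
    and \<beta>_pos: "\<beta> > 0" and reg: "beta_regular {-b..b} C \<beta> \<mu>"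
begin

interpretation \<mu>: prob_space \<mu> by (rule prob_\<mu>)

text \<open>Regularity is tested on the whole interval: its mass is 1 and a \<open>powr\<close> is
  nonnegative, so a negative constant is impossible.\<close>

lemma beta_regular_const_nonneg: "C \<ge> 0"
proof -
  have "1 \<le> C * measure lborel {-b..b} powr \<beta>"
    using beta_regular_measure_le[OF reg sets_\<mu>, of "{-b..b}"] supp_\<mu> by simp
  then show ?thesis
    by (smt (verit) mult_nonneg_nonneg mult_nonpos_nonneg powr_ge_zero)
qed

lemma measure_outside_support: "measure \<mu> (- {-b..b}) = 0"
  using \<mu>.prob_compl[of "{-b..b}"] supp_\<mu> sets_\<mu> sets_eq_imp_space_eq[OF sets_\<mu>]
  by (simp add: Compl_eq_Diff_UNIV)

text \<open>Inside the interval a point has length 0 and \<open>0 powr \<beta> = 0\<close>; outside,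
  it lies in the null complement. The absence of atoms serves both to discard the singular point in
  the probability estimate and to make invertibility hold almost surely.\<close>

lemma measure_singleton_zero: "measure \<mu> {c} = 0"
proof (cases "c \<in> {-b..b}")
  case True
  have "measure \<mu> {c} \<le> C * measure lborel {c} powr \<beta>"
    using True by (intro beta_regular_measure_le[OF reg sets_\<mu>]) auto
  then show ?thesis
    using \<beta>_pos by (simp add: measure_le_0_iff)
next
  case False
  then have "measure \<mu> {c} \<le> measure \<mu> (- {-b..b})"
    using sets_\<mu> by (intro \<mu>.finite_measure_mono) auto
  then show ?thesis
    by (simp add: measure_outside_support measure_le_0_iff)
qed

text \<open>\<open>D\<close> is left free at \<open>r = a\<close> because \<open>matrix_inv\<close>
  has no specified value at a singular matrix. The constant adds those of the two ranges of
  \<epsilon>, so one bound covers both and does not depend on \<open>s\<close>.\<close>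

lemma prob_inverse_sum_le:
  fixes s :: complex and a \<epsilon> R :: real and D :: "real \<Rightarrow> complex"
  assumes "s \<noteq> 0" "\<epsilon> \<ge> 0" "b + \<bar>a\<bar> \<le> R" "R \<ge> 0"
    and D: "\<And>r. r \<noteq> a \<Longrightarrow> D r = 1 / (complex_of_real r - a) + 1 / s"
  shows "measure \<mu> {r. cmod (D r) \<le> \<epsilon>}
           \<le> (C * (4 * R\<^sup>2) powr \<beta> + (2 * R) powr \<beta>) * \<epsilon> powr \<beta>"
proof (cases "\<epsilon> * R \<le> 1 / 2")
  case True
  \<comment> \<open>The real number \<open>r\<close> is located through the real part of
    \<open>r - a + s\<close>, which is \<open>r - c\<close>. For \<open>s = J + a\<close> this
    centre is \<open>-Re J\<close>.\<close>
  define c where "c = a - Re s"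
  let ?I = "{c - 2 * R\<^sup>2 * \<epsilon>..c + 2 * R\<^sup>2 * \<epsilon>} \<inter> {-b..b}"
  \<comment> \<open>The bound on the modulus of \<open>r - a\<close> by \<open>R\<close> needs
    \<open>r\<close> in the support and the formula for \<open>D\<close> needs
    \<open>r \<noteq> a\<close>; both exceptional sets are null.\<close>
  have "{r. cmod (D r) \<le> \<epsilon>} \<subseteq> ?I \<union> (- {-b..b} \<union> {a})"
  proof (intro subsetI UnCI)
    fix r assume *: "r \<in> {r. cmod (D r) \<le> \<epsilon>}" "r \<notin> - {-b..b} \<union> {a}"
    then have r: "r \<in> {-b..b}" "r \<noteq> a"
      by auto
    have "complex_of_real r - a \<noteq> 0"
      using r(2) by simp
    moreover have "cmod (complex_of_real r - a) \<le> R"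
      using r(1) assms(3) unfolding of_real_diff[symmetric] norm_of_real by auto
    ultimately have "cmod ((complex_of_real r - a) + s) \<le> 2 * R\<^sup>2 * \<epsilon>"
      using * True assms(1) D[OF r(2)] by (intro norm_add_le_of_norm_inverse_add_le) auto
    then have "\<bar>r - c\<bar> \<le> 2 * R\<^sup>2 * \<epsilon>"
      using abs_Re_le_cmod[of "(complex_of_real r - a) + s"] by (simp add: c_def)
    then show "r \<in> ?I"
      using r(1) by auto
  qed
  then have "measure \<mu> {r. cmod (D r) \<le> \<epsilon>} \<le> measure \<mu> (?I \<union> (- {-b..b} \<union> {a}))"
    using sets_\<mu> by (intro \<mu>.finite_measure_mono) auto
  also have "\<dots> \<le> measure \<mu> ?I + (measure \<mu> (- {-b..b}) + measure \<mu> {a})"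
    using sets_\<mu>
    by (intro order_trans[OF measure_Un_le] add_left_mono) auto
  also have "\<dots> = measure \<mu> ?I"
    by (simp add: measure_outside_support measure_singleton_zero)
  also have "\<dots> \<le> C * (2 * (2 * R\<^sup>2 * \<epsilon>)) powr \<beta>"
    using assms(2) \<beta>_pos beta_regular_const_nonneg
    by (intro beta_regular_interval_le[OF reg sets_\<mu>]) auto
  also have "\<dots> = C * (4 * R\<^sup>2) powr \<beta> * \<epsilon> powr \<beta>"
    using assms(2) by (simp add: powr_mult[symmetric] mult.assoc)
  also have "\<dots> \<le> (C * (4 * R\<^sup>2) powr \<beta> + (2 * R) powr \<beta>) * \<epsilon> powr \<beta>"
    by (intro mult_right_mono) auto
  finally show ?thesis .
next
  case False
  have "measure \<mu> {r. cmod (D r) \<le> \<epsilon>} \<le> 1"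
    by simp
  also have "1 \<le> (2 * R * \<epsilon>) powr \<beta>"
    using False \<beta>_pos by (intro ge_one_powr_ge_zero) (auto simp: algebra_simps)
  also have "\<dots> = (2 * R) powr \<beta> * \<epsilon> powr \<beta>"
    using assms(2,4) by (simp add: powr_mult)
  also have "\<dots> \<le> (C * (4 * R\<^sup>2) powr \<beta> + (2 * R) powr \<beta>) * \<epsilon> powr \<beta>"
    using beta_regular_const_nonneg by (intro mult_right_mono) auto
  finally show ?thesis .
qed

end

section \<open>Assumption (A) for the scalar field\<close>

lemma det_matrix_inv_add_1x1:
  fixes A B :: "'a::field ^ 1 ^ 1"
  assumes "A $ 1 $ 1 \<noteq> 0" "B $ 1 $ 1 \<noteq> 0"
  shows "det (matrix_inv A + matrix_inv B) = 1 / A $ 1 $ 1 + 1 / B $ 1 $ 1"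
  using assms by (simp add: matrix_inv_1x1 det_1)

text \<open>Singletons are closed in a T1 space, so an arbitrary value at one point does no harm.
  This handles the unspecified value of \<open>matrix_inv\<close> at the singular point.\<close>

lemma borel_measurable_eq_except_point:
  fixes f g :: "'a::t1_space \<Rightarrow> 'b::topological_space"
  assumes "g \<in> borel_measurable borel" "\<And>x. x \<noteq> a \<Longrightarrow> f x = g x"
  shows "f \<in> borel_measurable borel"
proof -
  have "f = (\<lambda>x. if x = a then f a else g x)"
    using assms(2) by auto
  also have "\<dots> \<in> borel_measurable borel"
    using assms(1) by (intro measurable_If) auto
  finally show ?thesis .
qed

text \<open>Keeping \<open>\<Omega>\<^sub>0\<close> general makes the almost sure and the sure
  version instances of one result: only the invertibility clause refers to it, while the probability
  bound is over all of \<open>space M\<close>.\<close>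

lemma assumption_A_on_of_beta_regular:
  fixes v :: "'x \<Rightarrow> 'w \<Rightarrow> real" and S :: "int set"
  assumes "prob_space M"
    and indep: "prob_space.indep_vars M (\<lambda>_. borel) v \<Lambda>"
    and distr: "\<And>x. x \<in> \<Lambda> \<Longrightarrow> distr M borel (v x) = \<mu>"
    and "b > 0" and supp: "measure \<mu> {-b..b} = 1"
    and "\<beta> > 0" and reg: "beta_regular {-b..b} C \<beta> \<mu>"
    and S: "finite S" "card S = 2 * n"
    and avoid: "\<And>x a \<omega>. x \<in> \<Lambda> \<Longrightarrow> a \<in> S \<Longrightarrow> \<omega> \<in> \<Omega>\<^sub>0 \<Longrightarrow> v x \<omega> \<noteq> of_int a"
  shows "assumption_A_on M \<Omega>\<^sub>0 \<Lambda>
           (\<lambda>x \<omega>. mat (complex_of_real (v x \<omega>)) :: complex ^ 1 ^ 1) n S \<beta>"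
proof -
  interpret prob_space M by fact
  \<comment> \<open>The sum dominates every single \<open>\<bar>a\<bar>\<close>, so
    \<open>R\<close>, and with it \<open>K\<close>, is the same for all \<open>a\<close> in
    \<open>S\<close>.\<close>
  define R where "R = b + (\<Sum>a\<in>S. \<bar>real_of_int a\<bar>)"
  define K where "K = C * (4 * R\<^sup>2) powr \<beta> + (2 * R) powr \<beta>"
  have K: "measure M {\<omega>\<in>space M.
            cmod (det (matrix_inv (mat (complex_of_real (v x \<omega>)) - mat (of_int a))
                       + matrix_inv (J + mat (of_int a)))) \<le> \<epsilon>} \<le> K * \<epsilon> powr \<beta>"
    if x: "x \<in> \<Lambda>" and a: "a \<in> S" and \<epsilon>: "\<epsilon> \<in> {0..1::real}"
      and J: "invertible (J + mat (of_int a))"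
    for x a \<epsilon> and J :: "complex ^ 1 ^ 1"
  proof -
    define s where "s = (J + mat (of_int a)) $ 1 $ 1"
    have s: "s \<noteq> 0"
      using J by (simp add: s_def invertible_1x1_iff del: vector_add_component)
    define D where "D r = det (matrix_inv (mat (complex_of_real r) - mat (of_int a))
                       + matrix_inv (J + mat (of_int a)))" for r
    have D: "D r = 1 / (complex_of_real r - complex_of_real (of_int a)) + 1 / s"
      if "r \<noteq> of_int a" for r
    proof -
      have "(mat (complex_of_real r) - mat (of_int a) :: complex ^ 1 ^ 1) $ 1 $ 1
              = complex_of_real r - complex_of_real (of_int a)"
        by (simp add: mat_def)
      moreover have "complex_of_real r - complex_of_real (of_int a) \<noteq> 0"
        using that by (metis eq_iff_diff_eq_0 of_real_eq_iff)
      ultimately show ?thesis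
        unfolding D_def using s
        by (subst det_matrix_inv_add_1x1) (simp_all only: s_def not_False_eq_True)
    qed
    have [measurable]: "D \<in> borel_measurable borel"
      by (rule borel_measurable_eq_except_point[OF _ D]) measurable
    have vx: "v x \<in> borel_measurable M"
      using indep x by (simp add: indep_vars_def)
    have \<mu>: "\<mu> = distr M borel (v x)"
      using distr x by simp
    have "\<bar>real_of_int a\<bar> \<le> (\<Sum>a\<in>S. \<bar>real_of_int a\<bar>)"
      using S(1) a by (intro member_le_sum) auto
    then have R: "b + \<bar>real_of_int a\<bar> \<le> R" "R \<ge> 0"
      using \<open>b > 0\<close> by (auto simp: R_def)
    \<comment> \<open>The event depends on the sample only through \<open>v x\<close>, so its
      probability is computed under the law \<mu>; this is where measurability of \<open>D\<close>
      enters.\<close>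
    have "measure M {\<omega>\<in>space M. cmod (D (v x \<omega>)) \<le> \<epsilon>} = measure \<mu> {r. cmod (D r) \<le> \<epsilon>}"
      unfolding \<mu> by (subst measure_distr[OF vx]) (auto intro!: arg_cong[where f = "measure M"])
    also have "\<dots> \<le> K * \<epsilon> powr \<beta>"
      unfolding K_def
      using s \<epsilon> R D \<open>\<beta> > 0\<close> supp reg vx
      by (intro prob_inverse_sum_le) (auto simp: \<mu> intro: prob_space_distr)
    finally show ?thesis
      by (simp only: D_def)
  qed
  have inv: "invertible (mat (complex_of_real (v x \<omega>)) - mat (of_int a) :: complex ^ 1 ^ 1)"
    if "x \<in> \<Lambda>" "a \<in> S" "\<omega> \<in> \<Omega>\<^sub>0" for x a \<omega>
    using avoid[OF that] by (simp add: invertible_1x1_iff mat_def)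
      (metis of_real_eq_iff of_real_of_int_eq)
  show ?thesis
    unfolding assumption_A_on_def
    by (intro conjI exI[of _ K] ballI allI impI iid_hermitian_field_mat[OF assms(1) indep distr]
        S(1) \<open>\<beta> > 0\<close> inv K) (use S(2) in auto)
qed

theorem theorem1p4:
  fixes M :: "'w measure"
    and \<Lambda> :: "(int ^ 'd) set"
    and v :: "int ^ 'd \<Rightarrow> 'w \<Rightarrow> real"
    and \<mu> :: "real measure"
    and b C \<beta> :: real
    and n :: nat
    and S :: "int set"
  assumes "prob_space M"
    and "prob_space.indep_vars M (\<lambda>_. borel) v \<Lambda>"
    and "\<And>x. x \<in> \<Lambda> \<Longrightarrow> distr M borel (v x) = \<mu>"
    and "b > 0"
    and "measure \<mu> {-b..b} = 1"
    and "\<beta> > 0"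
    and "beta_regular {-b..b} C \<beta> \<mu>"
    and "finite S"
    and "card S = 2 * n"
  shows "(\<exists>\<Omega>\<^sub>0\<in>sets M. measure M \<Omega>\<^sub>0 = 1 \<and>
            assumption_A_on M \<Omega>\<^sub>0 \<Lambda>
              (\<lambda>x \<omega>. mat (complex_of_real (v x \<omega>)) :: complex ^ 1 ^ 1) n S \<beta>)
       \<and> ((\<forall>x\<in>\<Lambda>. \<forall>\<omega>\<in>space M. v x \<omega> \<in> {-b..b}) \<and>
          (\<forall>a\<in>S. real_of_int a \<notin> {-b..b}) \<longrightarrow>
            assumption_A M \<Lambda>
              (\<lambda>x \<omega>. mat (complex_of_real (v x \<omega>)) :: complex ^ 1 ^ 1) n S \<beta>)"
proof
  interpret prob_space M by fact
  have v: "v x \<in> borel_measurable M" if "x \<in> \<Lambda>" for x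
    using assms(2) that by (simp add: indep_vars_def)
  \<comment> \<open>This is exactly the event that every matrix in question is invertible.\<close>
  define \<Omega>\<^sub>0 where "\<Omega>\<^sub>0 = {\<omega>\<in>space M. \<forall>x\<in>\<Lambda>. \<forall>a\<in>S. v x \<omega> \<noteq> of_int a}"
  have "AE \<omega> in M. v x \<omega> \<noteq> of_int a" if "x \<in> \<Lambda>" for x a
  proof -
    have \<mu>: "\<mu> = distr M borel (v x)"
      using assms(3) that by simp
    have "measure \<mu> {of_int a} = 0"
      using v[OF that] assms(5-7)
      by (intro measure_singleton_zero[of \<mu> b \<beta> C]) (auto simp: \<mu> intro: prob_space_distr)
    then have "measure M (v x -` {of_int a} \<inter> space M) = 0"
      unfolding \<mu> by (subst (asm) measure_distr[OF v[OF that]]) auto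
    then have "v x -` {of_int a} \<inter> space M \<in> null_sets M"
      using measurable_sets[OF v[OF that]] by (simp add: null_sets_def emeasure_eq_measure)
    from AE_not_in[OF this] show ?thesis
      by (rule AE_mp) auto
  qed
  \<comment> \<open>The lattice \<open>int ^ 'd\<close> and the integers are countable, so the
    exceptional null sets have a null union even for infinite \<Lambda>.\<close>
  then have "AE \<omega> in M. \<forall>x\<in>\<Lambda>. \<forall>a\<in>S. v x \<omega> \<noteq> of_int a"
    by (simp add: AE_ball_countable)
  moreover have "\<Omega>\<^sub>0 \<in> sets M"
  proof -
    have "Measurable.pred M (\<lambda>\<omega>. v x \<omega> \<noteq> of_int a)" if "x \<in> \<Lambda>" for x a
      using v[OF that] by measurable
    then have "Measurable.pred M (\<lambda>\<omega>. \<forall>x\<in>\<Lambda>. \<forall>a\<in>S. v x \<omega> \<noteq> of_int a)"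
      by (intro pred_intros_countable_bounded) auto
    then show ?thesis
      by (simp add: \<Omega>\<^sub>0_def pred_def)
  qed
  ultimately have "\<Omega>\<^sub>0 \<in> sets M" "measure M \<Omega>\<^sub>0 = 1"
    by (auto simp: \<Omega>\<^sub>0_def prob_Collect_eq_1)
  moreover have "assumption_A_on M \<Omega>\<^sub>0 \<Lambda>
              (\<lambda>x \<omega>. mat (complex_of_real (v x \<omega>)) :: complex ^ 1 ^ 1) n S \<beta>"
    using assms by (intro assumption_A_on_of_beta_regular) (auto simp: \<Omega>\<^sub>0_def)
  ultimately show "\<exists>\<Omega>\<^sub>0\<in>sets M. measure M \<Omega>\<^sub>0 = 1 \<and> assumption_A_on M \<Omega>\<^sub>0 \<Lambda>
              (\<lambda>x \<omega>. mat (complex_of_real (v x \<omega>)) :: complex ^ 1 ^ 1) n S \<beta>"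
    by blast
  show "(\<forall>x\<in>\<Lambda>. \<forall>\<omega>\<in>space M. v x \<omega> \<in> {-b..b}) \<and>
          (\<forall>a\<in>S. real_of_int a \<notin> {-b..b}) \<longrightarrow>
            assumption_A M \<Lambda>
              (\<lambda>x \<omega>. mat (complex_of_real (v x \<omega>)) :: complex ^ 1 ^ 1) n S \<beta>"
  proof
    assume *: "(\<forall>x\<in>\<Lambda>. \<forall>\<omega>\<in>space M. v x \<omega> \<in> {-b..b}) \<and> (\<forall>a\<in>S. real_of_int a \<notin> {-b..b})"
    \<comment> \<open>Values inside the interval never meet integers outside it, so all of
      \<open>space M\<close> can serve as \<open>\<Omega>\<^sub>0\<close>.\<close>
    then have "v x \<omega> \<noteq> of_int a" if "x \<in> \<Lambda>" "a \<in> S" "\<omega> \<in> space M" for x a \<omega>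
      using that by metis
    with assms show "assumption_A M \<Lambda>
              (\<lambda>x \<omega>. mat (complex_of_real (v x \<omega>)) :: complex ^ 1 ^ 1) n S \<beta>"
      unfolding assumption_A_def by (intro assumption_A_on_of_beta_regular) auto
  qed
qed

end
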